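(* Let $f\colon[0,\infty)\times[0,\infty)\times\mathbb R^n\to\mathbb R^n$ satisfy: (a) for every $r>0$, $f$ is bounded and continuous when restricted to $[0,\infty)\times[0,\infty)\times\{x\in\mathbb R^n: |x|\le r\}$; (b) for every $r>0$ there exist a modulus of continuity $\theta_r$ and a constant $L_r>0$ such that $|f(\tau,t_1,x_1)-f(\tau,t_2,x_2)|\le\theta_r(|t_1-t_2|)+L_r|x_1-x_2|$ for all $\tau,t_1,t_2\ge 0$ and $|x_1|,|x_2|\le r$; (c) for every $(t,x)\in[0,\infty)\times\mathbb R^n$ the limit $\hat f(t,x):=\lim_{T\to\infty}\frac1T\int_0^T f(s,t,x)\,ds$ exists; (d) for every $r>0$, $\hat f(t,x)=\lim_{T\to\infty}\frac1T\int_\tau^{T+\tau} f(s,t,x)\,ds$ uniformly for $(\tau,t,x)\in[0,\infty)\times[0,\infty)\times\{|x|\le r\}$. Take $\hat x\in\mathbb R^n$ and assume that $\tilde z(t;0,\hat x)$ is a uniformly asymptotically stable solution of $dz/dt=\hat f(t,z)$ and that $\{\tilde z(t;0,\hat x):t\ge0\}$ is bounded. Then, for all $\sigma>0$, there exists $\varepsilon_\sigma>0$ such that, if $0<\varepsilon<\varepsilon_\sigma$, then $\tilde x_\varepsilon(t;0,\hat x)$ exists for all $t>0$ and satisfies $$|\tilde x_\varepsilon(t;0,\hat x)-\tilde z(t;0,\hat x)|\le\sigma\quad\text{for all } t\ge0;$$ or, equivalently, $x_\varepsilon(\tau;0,\hat x)$ exists for all $\tau>0$ and satisfies $|x_\varepsilon(\tau;0,\hat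 x)-z_\varepsilon(\tau;0,\hat x)|\le\sigma$ for all $\tau\ge0$.
   Context: A modulus of continuity is a nondecreasing map $\theta\colon[0,\infty)\to[0,\infty]$ with $\lim_{r\to0^+}\theta(r)=0$. $|\cdot|$ is the Euclidean norm. For $\varepsilon>0$, $x_\varepsilon(\tau;\tau^*,x^* )$ and $z_\varepsilon(\tau;\tau^*,x^* )$ are the maximal solutions (for $\tau\ge\tau^*$) of $dx/d\tau=\varepsilon f(\tau,\varepsilon\tau,x)$ and $dz/d\tau=\varepsilon\hat f(\varepsilon\tau,z)$ with value $x^*$ at $\tau=\tau^*\ge0$; $\tilde x_\varepsilon(t;t^*,x^* )$ and $\tilde z(t;t^*,x^* )$ are the maximal solutions (for $t\ge t^*$) of $dx/dt=f(t/\varepsilon,t,x)$ and $dz/dt=\hat f(t,z)$ with value $x^*$ at $t=t^*\ge0$. Thus $\tilde x_\varepsilon(\varepsilon\tau;\varepsilon\tau^*,x^* )=x_\varepsilon(\tau;\tau^*,x^* )$ and $\tilde z(\varepsilon\tau;\varepsilon\tau^*,x^* )=z_\varepsilon(\tau;\tau^*,x^* )$. For $t^*\ge0$, a solution $\tilde z(t;t^*,x^* )$ of $dz/dt=\hat f(t,z)$ is uniformly asymptotically stable if it is defined on $[t^*,\infty)$ and there exists $\mu>0$ such that, for all $0<\sigma\le\mu$, there exists $s_\sigma\ge0$ such that, whenever $s^*\ge t^*$ and $|\tilde z(s^*;t^*,x^* )-z^*|\le\mu$, the solution $\tilde z(t;s^*,z^* )$ is defined for all $t\ge s^*$ and satisfies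 $|\tilde z(t;t^*,x^* )-\tilde z(t;s^*,z^* )|\le\sigma$ for all $t\ge s^*+s_\sigma$. *)

theory Defs
  imports "HOL-Analysis.Analysis"
begin

definition modulus_of_continuity :: "(real \<Rightarrow> ennreal) \<Rightarrow> bool" where
  "modulus_of_continuity \<theta> \<longleftrightarrow> mono_on {0..} \<theta> \<and> (\<theta> \<longlongrightarrow> 0) (at_right 0)"

(* Only solutions forward in time are considered, so t0 is the left endpoint of J, and the
   derivative at an endpoint of J is one-sided. *)
definition solution_on ::
  "(real \<Rightarrow> 'a::real_normed_vector \<Rightarrow> 'a) \<Rightarrow> real \<Rightarrow> 'a \<Rightarrow> real set \<Rightarrow> (real \<Rightarrow> 'a) \<Rightarrow> bool" where
  "solution_on g t0 x0 J x \<longleftrightarrow>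
     is_interval J \<and> t0 \<in> J \<and> J \<subseteq> {t0..} \<and> x t0 = x0 \<and>
     (\<forall>t\<in>J. (x has_vector_derivative g t (x t)) (at t within J))"

definition maximal_solution_on ::
  "(real \<Rightarrow> 'a::real_normed_vector \<Rightarrow> 'a) \<Rightarrow> real \<Rightarrow> 'a \<Rightarrow> real set \<Rightarrow> (real \<Rightarrow> 'a) \<Rightarrow> bool" where
  "maximal_solution_on g t0 x0 J x \<longleftrightarrow>
     solution_on g t0 x0 J x \<and>
     (\<forall>K y. solution_on g t0 x0 K y \<and> J \<subseteq> K \<and> (\<forall>t\<in>J. y t = x t) \<longrightarrow> K = J)"

(* A maximal solution always exists (by Zorn's lemma, starting from the trivial interval {t0}),
   and when the initial value problem has the uniqueness property, as for fields that are locally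
   Lipschitz in the state, its interval and its values on that interval do not depend on the
   choice made here.  Values outside the interval are meaningless. *)
definition maximal_solution ::
  "(real \<Rightarrow> 'a::real_normed_vector \<Rightarrow> 'a) \<Rightarrow> real \<Rightarrow> 'a \<Rightarrow> real set \<times> (real \<Rightarrow> 'a)" where
  "maximal_solution g t0 x0 = (SOME p. maximal_solution_on g t0 x0 (fst p) (snd p))"

definition sol_ivl :: "(real \<Rightarrow> 'a::real_normed_vector \<Rightarrow> 'a) \<Rightarrow> real \<Rightarrow> 'a \<Rightarrow> real set" where
  "sol_ivl g t0 x0 = fst (maximal_solution g t0 x0)"

definition sol :: "(real \<Rightarrow> 'a::real_normed_vector \<Rightarrow> 'a) \<Rightarrow> real \<Rightarrow> 'a \<Rightarrow> real \<Rightarrow> 'a" where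
  "sol g t0 x0 = snd (maximal_solution g t0 x0)"

definition uniformly_asymptotically_stable ::
  "(real \<Rightarrow> 'a::real_normed_vector \<Rightarrow> 'a) \<Rightarrow> real \<Rightarrow> 'a \<Rightarrow> bool" where
  "uniformly_asymptotically_stable g t0 x0 \<longleftrightarrow>
     sol_ivl g t0 x0 = {t0..} \<and>
     (\<exists>\<mu>>0. \<forall>\<sigma>. 0 < \<sigma> \<and> \<sigma> \<le> \<mu> \<longrightarrow>
       (\<exists>s\<sigma>\<ge>0. \<forall>s0 z0. s0 \<ge> t0 \<and> norm (sol g t0 x0 s0 - z0) \<le> \<mu> \<longrightarrow>
          sol_ivl g s0 z0 = {s0..} \<and>
          (\<forall>t\<ge>s0 + s\<sigma>. norm (sol g t0 x0 t - sol g s0 z0 t) \<le> \<sigma>)))"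

definition time_mean ::
  "(real \<Rightarrow> real \<Rightarrow> 'a::euclidean_space \<Rightarrow> 'a) \<Rightarrow> real \<Rightarrow> real \<Rightarrow> real \<Rightarrow> 'a \<Rightarrow> 'a" where
  "time_mean f T \<tau> t x = (1 / T) *\<^sub>R integral {\<tau>..T + \<tau>} (\<lambda>s. f s t x)"

(* The averaged field; meaningful only where the limit exists. *)
definition averaged ::
  "(real \<Rightarrow> real \<Rightarrow> 'a::euclidean_space \<Rightarrow> 'a) \<Rightarrow> real \<Rightarrow> 'a \<Rightarrow> 'a" where
  "averaged f t x = Lim at_top (\<lambda>T. time_mean f T 0 t x)"

end

(* On a time window of fixed length S the solution x of x' = f(t/eps, t, x) and the averaged
   solution w with the same initial value differ by at most a prescribed amount once eps is small,
   uniformly in the starting time: the integral of f(s/eps, s, w(s)) - fhat(s, w(s)) is small,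
   because on short pieces the slow arguments are frozen and the fast one averages out, and
   Gronwall's inequality transfers this to x - w.  By asymptotic stability S can be chosen so
   that an averaged solution that starts within delta of the reference orbit Z stays near Z and is
   within delta/2 of it after time S.  Hence x, which loses at most delta/2 per window, is again
   within delta of Z at the end, and the argument can be restarted on the next window with the
   averaged solution issued from the current value of x. *)
theory Submission
  imports Defs
begin

subsection \<open>Gronwall's inequality\<close>

lemma norm_integral_le_const:
  fixes f :: "real \<Rightarrow> 'a::banach"
  assumes "f integrable_on {a..b}" "a \<le> b" "\<And>t. t \<in> {a..b} \<Longrightarrow> norm (f t) \<le> B"
  shows "norm (integral {a..b} f) \<le> B * (b - a)"
proof -
  have "norm (integral {a..b} f) \<le> integral {a..b} (\<lambda>_. B)"
    by (rule Henstock_Kurzweil_Integration.integral_norm_bound_integral[OF assms(1)])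
      (use assms(3) in auto)
  then show ?thesis
    using assms(2) by (simp add: mult.commute)
qed

text \<open>With \<open>V\<close> the right-hand side of the assumed bound,
  \<open>V' = L v \<le> L V\<close>, so \<open>V\<close> divided by its expected exponential growth
  is nonincreasing; finally \<open>v b \<le> V b\<close>.\<close>

lemma gronwall_integral:
  fixes v :: "real \<Rightarrow> real"
  assumes ab: "a \<le> b" and L: "L \<ge> 0" and cont: "continuous_on {a..b} v"
    and le: "\<And>t. t \<in> {a..b} \<Longrightarrow> v t \<le> A + L * integral {a..t} v"
  shows "v b \<le> A * exp (L * (b - a))"
proof -
  define V where "V t = A + L * integral {a..t} v" for t
  define W where "W t = V t * exp (- L * (t - a))" for t
  have dV: "(V has_real_derivative L * v t) (at t within {a..b})" if "t \<in> {a..b}" for t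
    unfolding V_def
    by (auto intro!: derivative_eq_intros
        integral_has_vector_derivative[OF cont that,
          unfolded has_real_derivative_iff_has_vector_derivative[symmetric]])
  have dW: "(W has_real_derivative L * (v t - V t) * exp (- L * (t - a))) (at t within {a..b})"
    if "t \<in> {a..b}" for t
    unfolding W_def
    by (rule derivative_eq_intros dV that refl | simp add: algebra_simps)+
  have "W b \<le> W a"
  proof (rule DERIV_nonpos_imp_decreasing_open[OF ab])
    fix t assume t: "a < t" "t < b"
    have "L * (v t - V t) * exp (- L * (t - a)) \<le> 0"
      using le[of t] t L by (intro mult_nonpos_nonneg[OF mult_nonneg_nonpos]) (auto simp: V_def)
    then show "\<exists>y. DERIV W t :> y \<and> y \<le> 0"
      using dW[of t] t at_within_Icc_at[of a t b] by auto
  next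
    show "continuous_on {a..b} W"
      using dW by (rule DERIV_continuous_on)
  qed
  then have "V b \<le> A * exp (L * (b - a))"
    by (simp add: W_def V_def exp_minus divide_simps split: if_splits)
  then show ?thesis
    using le[of b] ab by (auto simp: V_def)
qed

text \<open>Only the integrals of the perturbation \<open>G\<close> have to be small, not
  \<open>G\<close> itself. Averaging needs exactly this: the difference between the original and the
  averaged field is of order one but oscillates fast, so that its integral is small.\<close>

lemma perturbed_gronwall:
  fixes u :: "real \<Rightarrow> 'a::euclidean_space"
  assumes ab: "a \<le> b" and L: "L \<ge> 0"
    and du: "\<And>t. t \<in> {a..b} \<Longrightarrow> (u has_vector_derivative p t + G t) (at t within {a..b})"
    and p: "\<And>t. t \<in> {a..b} \<Longrightarrow> norm (p t) \<le> L * norm (u t)"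
    and G: "G integrable_on {a..b}"
    and IG: "\<And>t. t \<in> {a..b} \<Longrightarrow> norm (integral {a..t} G) \<le> \<eta>"
  shows "norm (u b) \<le> (norm (u a) + \<eta>) * exp (L * (b - a))"
proof (rule gronwall_integral[OF ab L])
  have cu: "continuous_on {a..b} u"
    using du by (rule continuous_on_vector_derivative)
  then show cnu: "continuous_on {a..b} (\<lambda>t. norm (u t))"
    by (rule continuous_on_norm)
  fix t assume t: "t \<in> {a..b}"
  then have sub: "{a..t} \<subseteq> {a..b}" by auto
  have ftc: "((\<lambda>s. p s + G s) has_integral u t - u a) {a..t}"
  proof (rule fundamental_theorem_of_calculus)
    show "(u has_vector_derivative p s + G s) (at s within {a..t})" if "s \<in> {a..t}" for s
      by (rule has_vector_derivative_within_subset[OF du sub]) (use that sub in auto)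
  qed (use t in auto)
  have Gt: "G integrable_on {a..t}"
    using G sub integrable_on_subinterval by blast
  \<comment> \<open>Nothing is assumed about the regularity of \<open>p\<close>; it is the
    derivative of \<open>u\<close> minus \<open>G\<close>, and both are integrable.\<close>
  have pt: "p integrable_on {a..t}"
    using integrable_diff[OF has_integral_integrable[OF ftc] Gt] by simp
  have nu: "(\<lambda>s. L * norm (u s)) integrable_on {a..t}"
    by (intro integrable_continuous_real continuous_on_mult_left continuous_on_subset[OF cnu sub])
  have "u t = u a + integral {a..t} G + integral {a..t} p"
    using integral_unique[OF ftc] integral_add[OF pt Gt] by (simp add: algebra_simps)
  moreover have "norm (integral {a..t} p) \<le> integral {a..t} (\<lambda>s. L * norm (u s))"
    by (rule Henstock_Kurzweil_Integration.integral_norm_bound_integral[OF pt])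
      (use p sub nu in auto)
  ultimately show "norm (u t) \<le> norm (u a) + \<eta> + L * integral {a..t} (\<lambda>s. norm (u s))"
    using IG[OF t] norm_triangle_ineq[of "u a + integral {a..t} G" "integral {a..t} p"]
      norm_triangle_ineq[of "u a" "integral {a..t} G"]
    by simp
qed

corollary gronwall:
  fixes u :: "real \<Rightarrow> 'a::euclidean_space"
  assumes "a \<le> b" "L \<ge> 0"
    and "\<And>t. t \<in> {a..b} \<Longrightarrow> (u has_vector_derivative p t) (at t within {a..b})"
    and "\<And>t. t \<in> {a..b} \<Longrightarrow> norm (p t) \<le> L * norm (u t)"
  shows "norm (u b) \<le> norm (u a) * exp (L * (b - a))"
  using perturbed_gronwall[of a b L u p "\<lambda>_. 0" 0] assms by auto

subsection \<open>Existence, uniqueness and maximality of solutions\<close>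

lemma solution_onD:
  assumes "solution_on g t0 x0 J x"
  shows "is_interval J" "t0 \<in> J" "J \<subseteq> {t0..}" "x t0 = x0"
    "\<And>t. t \<in> J \<Longrightarrow> (x has_vector_derivative g t (x t)) (at t within J)"
  using assms by (auto simp: solution_on_def)

lemma solution_on_halflineD:
  assumes "solution_on g t0 x0 {t0..} x" "t0 \<le> a" "t \<in> {a..b}"
  shows "(x has_vector_derivative g t (x t)) (at t within {a..b})"
  by (rule has_vector_derivative_within_subset[OF solution_onD(5)[OF assms(1)]]) (use assms in auto)

lemma solution_on_continuous:
  assumes "solution_on g t0 x0 J x"
  shows "continuous_on J x"
  using solution_onD(5)[OF assms] by (rule continuous_on_vector_derivative)

section \<open>Global existence for bounded and globally Lipschitz fields\<close>

lemma global_solution_exists: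
  fixes g :: "real \<Rightarrow> 'a::euclidean_space \<Rightarrow> 'a"
  assumes cont: "continuous_on ({t0..} \<times> UNIV) (\<lambda>(t, x). g t x)"
    and bound: "\<And>t x. t \<ge> t0 \<Longrightarrow> norm (g t x) \<le> M"
    and lip: "\<And>t x y. t \<ge> t0 \<Longrightarrow> norm (g t x - g t y) \<le> L * norm (x - y)"
    and L: "L > 0"
  shows "\<exists>x. solution_on g t0 x0 {t0..} x"
proof -
  (* In the variable u = exp (-2L(t - t0)) (x - x0) the Picard operator T maps bounded continuous
     functions on the whole half-line to such functions and is a 1/2-contraction.  For t < t0 the
     value of T u is frozen at time t0, so that T u is continuous on all of the real line. *)
  define X where "X u s = x0 + exp (2 * L * (s - t0)) *\<^sub>R apply_bcontfun u s" for u s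
  define I where "I u t = integral {t0..t} (\<lambda>s. g s (X u s))" for u t
  define T where "T u t = exp (- 2 * L * (max t t0 - t0)) *\<^sub>R I u (max t t0)" for u t
  have M: "M \<ge> 0"
    using bound[of t0 0] norm_ge_zero order_trans by blast
  have gX: "continuous_on {t0..} (\<lambda>s. g s (X u s))" for u
    unfolding X_def by (rule continuous_on_compose2[OF cont, where f="\<lambda>s. (s, _ s)", simplified prod.case])
        (auto intro!: continuous_intros)
  then have gXi: "continuous_on {t0..b} (\<lambda>s. g s (X u s))" for u b
    by (rule continuous_on_subset) auto
  have gXint: "(\<lambda>s. g s (X u s)) integrable_on {t0..b}" for u b
    using gXi by (rule integrable_continuous_real)
  have dI: "(I u has_vector_derivative g t (X u t)) (at t within {t0..})" if "t \<ge> t0" for u t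
  proof -
    \<comment> \<open>The interval reaches beyond \<open>t\<close>, so that near \<open>t\<close> it
      coincides with the half-line.\<close>
    have "(I u has_vector_derivative g t (X u t)) (at t within {t0..t+1})"
      unfolding I_def by (rule integral_has_vector_derivative[OF gXi]) (use that in auto)
    moreover have "at t within {t0..t+1} = at t within {t0..}"
      by (rule at_within_nhd[of t "{..<t+1}"]) auto
    ultimately show ?thesis by simp
  qed
  then have cI: "continuous_on {t0..} (I u)" for u
    using continuous_on_vector_derivative[of "{t0..}" "I u" "\<lambda>t. g t (X u t)"] by auto
  have "T u \<in> bcontfun" for u
  proof (rule bcontfun_normI)
    show "continuous_on UNIV (T u)"
      unfolding T_def
      by (intro continuous_intros continuous_on_compose2[OF cI]) auto
    fix t
    define h where "h = max t t0 - t0"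
    have h: "h \<ge> 0" by (simp add: h_def)
    have "norm (I u (max t t0)) \<le> M * h"
      unfolding I_def h_def by (rule norm_integral_le_const[OF gXint]) (use bound in auto)
    then have "norm (T u t) \<le> exp (- 2 * L * h) * (M * h)"
      by (simp add: T_def h_def[symmetric])
    \<comment> \<open>The integral grows at most linearly, and the weight beats this:
      \<open>h exp (-2Lh) \<le> 1 / (2L)\<close>.\<close>
    also have "\<dots> \<le> M / (2 * L)"
    proof -
      have "2 * L * h \<le> exp (2 * L * h)"
        using exp_ge_add_one_self[of "2 * L * h"] by linarith
      then have "M * (2 * L * h) \<le> M * exp (2 * L * h)"
        using M by (rule mult_left_mono)
      then show ?thesis
        using L by (simp add: exp_minus field_simps)
    qed
    finally show "norm (T u t) \<le> M / (2 * L)" .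
  qed
  then have TB: "apply_bcontfun (Bcontfun (T u)) = T u" for u
    by (simp add: Bcontfun_inverse)
  have "dist (Bcontfun (T u)) (Bcontfun (T v)) \<le> 1/2 * dist u v" for u v
  proof (rule dist_bound)
    fix t
    define b where "b = max t t0"
    have b: "b \<ge> t0" by (simp add: b_def)
    \<comment> \<open>\<open>E\<close> is an antiderivative of \<open>L exp (2L(s - t0))\<close>.
      The factor 1/2, which becomes the contraction constant, arises because the exponent of the
      weight is twice the Lipschitz constant.\<close>
    define E where "E s = exp (2 * L * (s - t0)) / 2" for s
    have dE: "((\<lambda>s. E s * dist u v) has_vector_derivative L * exp (2 * L * (s - t0)) * dist u v) (at s within S)" for s S
      unfolding has_real_derivative_iff_has_vector_derivative[symmetric] E_def
      by (rule derivative_eq_intros refl | simp)+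
    have Eint: "((\<lambda>s. L * exp (2 * L * (s - t0)) * dist u v) has_integral E b * dist u v - E t0 * dist u v) {t0..b}"
      by (rule fundamental_theorem_of_calculus[OF b]) (rule dE)
    have "norm (I u b - I v b) = norm (integral {t0..b} (\<lambda>s. g s (X u s) - g s (X v s)))"
      unfolding I_def by (simp add: integral_diff[OF gXint gXint])
    also have "\<dots> \<le> integral {t0..b} (\<lambda>s. L * exp (2 * L * (s - t0)) * dist u v)"
    proof (rule Henstock_Kurzweil_Integration.integral_norm_bound_integral)
      fix s assume s: "s \<in> {t0..b}"
      have "norm (g s (X u s) - g s (X v s)) \<le> L * norm (X u s - X v s)"
        using lip s by auto
      also have "X u s - X v s = exp (2 * L * (s - t0)) *\<^sub>R (apply_bcontfun u s - apply_bcontfun v s)"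
        by (simp add: X_def algebra_simps)
      also have "L * norm \<dots> \<le> L * exp (2 * L * (s - t0)) * dist u v"
        using dist_bounded[of u s v] L by (simp add: dist_norm)
      finally show "norm (g s (X u s) - g s (X v s)) \<le> L * exp (2 * L * (s - t0)) * dist u v" .
    qed (use integrable_diff[OF gXint gXint] Eint in auto)
    also have "\<dots> \<le> E b * dist u v"
      using integral_unique[OF Eint] by (simp add: E_def)
    finally have "norm (I u b - I v b) \<le> E b * dist u v" .
    moreover have "dist (T u t) (T v t) = exp (- 2 * L * (b - t0)) * norm (I u b - I v b)"
      by (simp add: T_def b_def dist_norm scaleR_diff_right[symmetric])
    ultimately have "dist (T u t) (T v t) \<le> exp (- 2 * L * (b - t0)) * (E b * dist u v)"
      by simp
    then show "dist (apply_bcontfun (Bcontfun (T u)) t) (apply_bcontfun (Bcontfun (T v)) t) \<le> 1/2 * dist u v"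
      unfolding TB by (simp add: E_def mult.assoc[symmetric] exp_minus)
  qed
  then have "\<exists>!u. Bcontfun (T u) = u"
    by (intro banach_fix_type[of "1/2"]) auto
  then obtain u where "Bcontfun (T u) = u" by blast
  then have u: "apply_bcontfun u = T u" using TB[of u] by simp
  \<comment> \<open>For the fixed point the two exponential weights cancel, which leaves the
    integral equation of the initial value problem.\<close>
  have X: "X u t = x0 + I u t" if "t \<ge> t0" for t
    using that by (simp add: X_def u T_def max_def exp_minus)
  have "solution_on g t0 x0 {t0..} (X u)"
    unfolding solution_on_def
  proof (intro conjI ballI)
    show "X u t0 = x0" by (simp add: X I_def)
    fix t assume t: "t \<in> {t0..}"
    have "((\<lambda>t. x0 + I u t) has_vector_derivative g t (X u t)) (at t within {t0..})"
      using dI[of t u] t by (auto intro!: derivative_eq_intros)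
    then show "(X u has_vector_derivative g t (X u t)) (at t within {t0..})"
      using t X by (rule has_vector_derivative_transform[rotated -1]) auto
  qed (auto simp: is_interval_ci)
  then show ?thesis by blast
qed

section \<open>Uniqueness and maximal solutions under a local Lipschitz condition\<close>

definition locally_lipschitz_from :: "real \<Rightarrow> (real \<Rightarrow> 'a::real_normed_vector \<Rightarrow> 'a) \<Rightarrow> bool" where
  "locally_lipschitz_from t0 g \<longleftrightarrow>
     (\<forall>r>0. \<exists>L\<ge>0. \<forall>t\<ge>t0. \<forall>x y. norm x \<le> r \<longrightarrow> norm y \<le> r \<longrightarrow>
        norm (g t x - g t y) \<le> L * norm (x - y))"

lemma locally_lipschitz_from_mono:
  "locally_lipschitz_from t0 g \<Longrightarrow> t0 \<le> s0 \<Longrightarrow> locally_lipschitz_from s0 g"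
  unfolding locally_lipschitz_from_def by (meson order_trans)

lemma solution_on_Icc_subset:
  assumes "solution_on g t0 x0 J x" "t \<in> J"
  shows "{t0..t} \<subseteq> J"
  using mem_is_interval_1_I[OF solution_onD(1,2)[OF assms(1)] assms(2)] by auto

text \<open>On the compact interval up to \<open>t\<close> both curves stay in one ball, so a single
  Lipschitz constant serves and Gronwall's inequality applies with initial difference zero.\<close>

lemma solution_unique:
  fixes g :: "real \<Rightarrow> 'a::euclidean_space \<Rightarrow> 'a"
  assumes lip: "locally_lipschitz_from t0 g"
    and x: "solution_on g t0 x0 J x" and y: "solution_on g t0 x0 K y"
    and t: "t \<in> J" "t \<in> K"
  shows "x t = y t"
proof -
  have t0t: "t0 \<le> t" using solution_onD(3)[OF x] t by auto
  have J: "{t0..t} \<subseteq> J" and K: "{t0..t} \<subseteq> K"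
    using solution_on_Icc_subset x y t by blast+
  have "bounded (x ` {t0..t})" "bounded (y ` {t0..t})"
    by (intro compact_imp_bounded compact_continuous_image compact_Icc
          continuous_on_subset[OF solution_on_continuous[OF x] J]
          continuous_on_subset[OF solution_on_continuous[OF y] K])+
  then have "bounded (x ` {t0..t} \<union> y ` {t0..t})" by simp
  then obtain r where r: "r > 0" "\<And>s. s \<in> {t0..t} \<Longrightarrow> norm (x s) \<le> r"
    "\<And>s. s \<in> {t0..t} \<Longrightarrow> norm (y s) \<le> r"
    unfolding bounded_pos by auto
  obtain L where L: "L \<ge> 0" "\<And>s x y. s \<ge> t0 \<Longrightarrow> norm x \<le> r \<Longrightarrow> norm y \<le> r \<Longrightarrow>
      norm (g s x - g s y) \<le> L * norm (x - y)"
    using lip r(1) unfolding locally_lipschitz_from_def by meson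
  have "norm (x t - y t) \<le> norm (x t0 - y t0) * exp (L * (t - t0))"
  proof (rule gronwall[OF t0t L(1)])
    fix s assume s: "s \<in> {t0..t}"
    show "((\<lambda>s. x s - y s) has_vector_derivative g s (x s) - g s (y s)) (at s within {t0..t})"
      by (intro derivative_intros
          has_vector_derivative_within_subset[OF solution_onD(5)[OF x] J]
          has_vector_derivative_within_subset[OF solution_onD(5)[OF y] K]) (use s J K in auto)
    show "norm (g s (x s) - g s (y s)) \<le> L * norm (x s - y s)"
      using L(2) r s by auto
  qed
  then show ?thesis
    using solution_onD(4)[OF x] solution_onD(4)[OF y] by simp
qed

text \<open>By uniqueness all solutions agree on common times, so they glue to a solution on the
  union of their intervals. This union contains the interval of every solution, hence cannot be
  extended.\<close>

lemma maximal_solution_exists: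
  fixes g :: "real \<Rightarrow> 'a::euclidean_space \<Rightarrow> 'a"
  assumes lip: "locally_lipschitz_from t0 g"
  shows "\<exists>J x. maximal_solution_on g t0 x0 J x"
proof -
  define \<K> where "\<K> = {K. \<exists>y. solution_on g t0 x0 K y}"
  define Y where "Y K = (SOME y. solution_on g t0 x0 K y)" for K
  have Y: "solution_on g t0 x0 K (Y K)" if "K \<in> \<K>" for K
    using that unfolding \<K>_def Y_def by (simp add: someI_ex)
  define J where "J = \<Union>\<K>"
  define x where "x t = Y (SOME K. K \<in> \<K> \<and> t \<in> K) t" for t
  have xY: "x t = Y K t" if K: "K \<in> \<K>" and t: "t \<in> K" for t K
  proof -
    have "(SOME K. K \<in> \<K> \<and> t \<in> K) \<in> \<K> \<and> t \<in> (SOME K. K \<in> \<K> \<and> t \<in> K)"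
      using that by (intro someI[of "\<lambda>K. K \<in> \<K> \<and> t \<in> K" K]) auto
    then show ?thesis
      unfolding x_def using solution_unique[OF lip Y Y] K t by blast
  qed
  have conv: "{t0..t} \<subseteq> K" if "K \<in> \<K>" "t \<in> K" for t K
    using solution_on_Icc_subset[OF Y[OF that(1)] that(2)] .
  have ge: "t \<ge> t0" if "K \<in> \<K>" "t \<in> K" for t K
    using solution_onD(3)[OF Y[OF that(1)]] that(2) by auto
  have "solution_on g t0 x0 {t0} (\<lambda>_. x0)"
    by (auto simp: solution_on_def is_interval_1 has_vector_derivative_def has_derivative_within_singleton_iff
        intro!: bounded_linear_intros)
  then have single: "{t0} \<in> \<K>" unfolding \<K>_def by blast
  have "solution_on g t0 x0 J x"
    unfolding solution_on_def
  proof (intro conjI ballI)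
    show "is_interval J"
      unfolding is_interval_1
    proof (intro ballI allI impI)
      fix a b s assume ab: "a \<in> J" "b \<in> J" "a \<le> s \<and> s \<le> b"
      then obtain K where K: "K \<in> \<K>" "b \<in> K" by (auto simp: J_def)
      moreover have "t0 \<le> a" using ab ge by (auto simp: J_def)
      ultimately have "s \<in> K" using conv[OF K] ab by auto
      then show "s \<in> J" using K by (auto simp: J_def)
    qed
    show "t0 \<in> J" using single by (auto simp: J_def)
    show "J \<subseteq> {t0..}" using ge by (auto simp: J_def)
    show "x t0 = x0" using xY[OF single] solution_onD(4)[OF Y[OF single]] by simp
    fix t assume "t \<in> J"
    \<comment> \<open>A derivative within \<open>J\<close> can be read off from one piece
      \<open>K\<close> only if \<open>K\<close> coincides with \<open>J\<close> near
      \<open>t\<close>. If \<open>J\<close> continues beyond \<open>t\<close>, a piece reaching a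
      later time does this; otherwise \<open>t\<close> is the last point of \<open>J\<close>, and
      any piece containing it is all of \<open>J\<close>.\<close>
    then obtain K S where K: "K \<in> \<K>" "t \<in> K" and S: "open S" "t \<in> S" "J \<inter> S \<subseteq> K"
    proof (cases "\<exists>t'\<in>J. t' > t")
      case True
      then obtain t' K where t': "K \<in> \<K>" "t' \<in> K" "t < t'" by (auto simp: J_def)
      have "J \<inter> {..<t'} \<subseteq> K"
      proof
        fix s assume "s \<in> J \<inter> {..<t'}"
        then have "s \<ge> t0" "s \<le> t'" using ge by (auto simp: J_def)
        then show "s \<in> K" using conv[OF t'(1,2)] by auto
      qed
      moreover have "t \<in> K"
        using calculation t' \<open>t \<in> J\<close> by auto
      ultimately show ?thesis using that[of K "{..<t'}"] t' by auto
    next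
      case False
      obtain K where K: "K \<in> \<K>" "t \<in> K" using \<open>t \<in> J\<close> by (auto simp: J_def)
      have "J \<subseteq> K"
      proof
        fix s assume "s \<in> J"
        then have "s \<ge> t0" "s \<le> t" using ge False by (auto simp: J_def not_less)
        then show "s \<in> K" using conv[OF K] by auto
      qed
      then show ?thesis using that[of K UNIV] K by auto
    qed
    have "(Y K has_vector_derivative g t (Y K t)) (at t within K)"
      using solution_onD(5)[OF Y] K by blast
    then have "(x has_vector_derivative g t (x t)) (at t within K)"
      unfolding xY[OF K, symmetric]
      by (rule has_vector_derivative_transform[OF K(2), rotated]) (rule xY[OF K(1)])
    moreover have "at t within J = at t within K"
      by (rule at_within_nhd[OF S(2,1)]) (use S K in \<open>auto simp: J_def\<close>)
    ultimately show "(x has_vector_derivative g t (x t)) (at t within J)" by simp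
  qed
  then have "maximal_solution_on g t0 x0 J x"
    unfolding maximal_solution_on_def by (auto simp: J_def \<K>_def)
  then show ?thesis by blast
qed

lemma sol_maximal:
  fixes g :: "real \<Rightarrow> 'a::euclidean_space \<Rightarrow> 'a"
  assumes "locally_lipschitz_from t0 g"
  shows "maximal_solution_on g t0 x0 (sol_ivl g t0 x0) (sol g t0 x0)"
proof -
  obtain J x where "maximal_solution_on g t0 x0 (fst (J, x)) (snd (J, x))"
    using maximal_solution_exists[OF assms] by fastforce
  then show ?thesis
    unfolding sol_ivl_def sol_def maximal_solution_def by (rule someI)
qed

lemma solution_on_sol:
  fixes g :: "real \<Rightarrow> 'a::euclidean_space \<Rightarrow> 'a"
  assumes "locally_lipschitz_from t0 g" "sol_ivl g t0 x0 = J"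
  shows "solution_on g t0 x0 J (sol g t0 x0)"
  using sol_maximal[OF assms(1), of x0] assms(2) by (auto simp: maximal_solution_on_def)

text \<open>This links a solution constructed by hand to the chosen maximal one: by uniqueness the
  global solution extends the chosen one, and maximality then forces the intervals to be
  equal.\<close>

lemma global_solution_eq_sol:
  fixes g :: "real \<Rightarrow> 'a::euclidean_space \<Rightarrow> 'a"
  assumes lip: "locally_lipschitz_from t0 g" and x: "solution_on g t0 x0 {t0..} x"
  shows "sol_ivl g t0 x0 = {t0..}" "\<And>t. t \<ge> t0 \<Longrightarrow> sol g t0 x0 t = x t"
proof -
  have sub: "sol_ivl g t0 x0 \<subseteq> {t0..}"
    using solution_onD(3)[OF solution_on_sol[OF lip refl]] .
  then have "\<forall>t\<in>sol_ivl g t0 x0. x t = sol g t0 x0 t"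
    using solution_unique[OF lip x solution_on_sol[OF lip refl]] by auto
  then show *: "sol_ivl g t0 x0 = {t0..}"
    using sol_maximal[OF lip, of x0] x sub unfolding maximal_solution_on_def by metis
  show "sol g t0 x0 t = x t" if "t \<ge> t0" for t
    using solution_unique[OF lip solution_on_sol[OF lip *] x] that by simp
qed

subsection \<open>Averaging on bounded time windows\<close>

text \<open>The hypotheses on the field for one fixed ball, with its constants named.
  \<open>equicont\<close> is the real-valued content of the modulus of continuity in the slow time,
  uniform in the fast time and the state.\<close>

locale averaging =
  fixes f :: "real \<Rightarrow> real \<Rightarrow> 'a::euclidean_space \<Rightarrow> 'a" and r M L :: real
  assumes r: "r > 0" and M: "M > 0" and L: "L > 0"
    and bound: "\<And>\<tau> t x. \<tau> \<ge> 0 \<Longrightarrow> t \<ge> 0 \<Longrightarrow> norm x \<le> r \<Longrightarrow> norm (f \<tau> t x) \<le> M"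
    and lip: "\<And>\<tau> t x y. \<tau> \<ge> 0 \<Longrightarrow> t \<ge> 0 \<Longrightarrow> norm x \<le> r \<Longrightarrow> norm y \<le> r \<Longrightarrow>
      norm (f \<tau> t x - f \<tau> t y) \<le> L * norm (x - y)"
    and equicont: "\<And>\<eta>. \<eta> > 0 \<Longrightarrow> \<exists>d>0. \<forall>\<tau> t s x. \<tau> \<ge> 0 \<longrightarrow> t \<ge> 0 \<longrightarrow> s \<ge> 0 \<longrightarrow> norm x \<le> r \<longrightarrow>
      \<bar>t - s\<bar> < d \<longrightarrow> norm (f \<tau> t x - f \<tau> s x) \<le> \<eta>"
    and cont: "continuous_on ({0..} \<times> {0..} \<times> {x. norm x \<le> r}) (\<lambda>(\<tau>, t, x). f \<tau> t x)"
    and unif: "uniform_limit ({0..} \<times> {0..} \<times> {x. norm x \<le> r})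
      (\<lambda>T (\<tau>, t, x). time_mean f T \<tau> t x) (\<lambda>(\<tau>, t, x). averaged f t x) at_top"
begin

section \<open>Bounds inherited by the averaged field\<close>

lemma continuous_on_f:
  assumes "continuous_on S a" "continuous_on S b" "continuous_on S c"
    and "\<And>s. s \<in> S \<Longrightarrow> a s \<ge> 0" "\<And>s. s \<in> S \<Longrightarrow> b s \<ge> 0" "\<And>s. s \<in> S \<Longrightarrow> norm (c s) \<le> r"
  shows "continuous_on S (\<lambda>s. f (a s) (b s) (c s))"
proof -
  have "continuous_on S (\<lambda>s. (a s, b s, c s))"
    by (intro continuous_on_Pair assms)
  from continuous_on_compose2[OF cont this] show ?thesis
    using assms(4-6) by auto
qed

lemma integrable_fast:
  assumes "t \<ge> 0" "norm x \<le> r" "a \<ge> 0"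
  shows "(\<lambda>s. f s t x) integrable_on {a..b}"
  using assms by (intro integrable_continuous_real continuous_on_f continuous_intros) auto

lemma averaged_tendsto:
  assumes "t \<ge> 0" "norm x \<le> r"
  shows "((\<lambda>T. time_mean f T 0 t x) \<longlongrightarrow> averaged f t x) at_top"
  using tendsto_uniform_limitI[OF unif, of "(0, t, x)"] assms by simp

lemma norm_averaged_le:
  assumes t: "t \<ge> 0" "norm x \<le> r"
  shows "norm (averaged f t x) \<le> M"
proof (rule tendsto_upperbound[OF tendsto_norm[OF averaged_tendsto[OF t]]])
  show "\<forall>\<^sub>F T in at_top. norm (time_mean f T 0 t x) \<le> M"
  proof (rule eventually_mono[OF eventually_gt_at_top[of 0]])
    fix T :: real assume T: "T > 0"
    have "norm (integral {0..T} (\<lambda>s. f s t x)) \<le> M * (T - 0)"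
      by (rule norm_integral_le_const[OF integrable_fast]) (use t T bound in auto)
    then show "norm (time_mean f T 0 t x) \<le> M"
      using T by (simp add: time_mean_def field_simps)
  qed
qed simp

text \<open>A bound that is uniform in the fast time survives taking means and limits. Allowing both
  slow time and state to differ gives the Lipschitz bound and the freezing error of the averaged
  field from the same lemma.\<close>

lemma norm_averaged_diff_le:
  assumes x: "t \<ge> 0" "norm x \<le> r" and y: "s \<ge> 0" "norm y \<le> r"
    and c: "\<And>\<tau>. \<tau> \<ge> 0 \<Longrightarrow> norm (f \<tau> t x - f \<tau> s y) \<le> c"
  shows "norm (averaged f t x - averaged f s y) \<le> c"
proof (rule tendsto_upperbound[OF tendsto_norm[OF tendsto_diff[OF averaged_tendsto[OF x] averaged_tendsto[OF y]]]])
  show "\<forall>\<^sub>F T in at_top. norm (time_mean f T 0 t x - time_mean f T 0 s y) \<le> c"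
  proof (rule eventually_mono[OF eventually_gt_at_top[of 0]])
    fix T :: real assume T: "T > 0"
    have "norm (integral {0..T} (\<lambda>\<tau>. f \<tau> t x - f \<tau> s y)) \<le> c * (T - 0)"
      by (rule norm_integral_le_const) (use x y T c in \<open>auto intro!: integrable_diff integrable_fast\<close>)
    moreover have "time_mean f T 0 t x - time_mean f T 0 s y
        = (1 / T) *\<^sub>R integral {0..T} (\<lambda>\<tau>. f \<tau> t x - f \<tau> s y)"
      using x y by (simp add: time_mean_def integral_diff integrable_fast scaleR_diff_right)
    ultimately show "norm (time_mean f T 0 t x - time_mean f T 0 s y) \<le> c"
      using T by (simp add: field_simps)
  qed
qed simp

lemma averaged_lip:
  assumes "t \<ge> 0" "norm x \<le> r" "norm y \<le> r"
  shows "norm (averaged f t x - averaged f t y) \<le> L * norm (x - y)"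
  using assms by (intro norm_averaged_diff_le lip)

text \<open>A window of length \<open>h\<close> in slow time is one of length
  \<open>h / \<epsilon>\<close> in fast time, so small \<open>\<epsilon>\<close> means a long mean.
  Its start \<open>a / \<epsilon>\<close> is arbitrarily late, which is why means must converge
  uniformly in their starting time.\<close>

lemma integral_rescaled:
  assumes "\<epsilon> > 0" "h > 0" "a \<ge> 0" "t \<ge> 0" "norm x \<le> r"
  shows "((\<lambda>s. f (s / \<epsilon>) t x) has_integral h *\<^sub>R time_mean f (h / \<epsilon>) (a / \<epsilon>) t x) {a..a + h}"
proof -
  have "((\<lambda>s. f s t x) has_integral integral {a/\<epsilon>..h/\<epsilon> + a/\<epsilon>} (\<lambda>s. f s t x)) {a/\<epsilon>..h/\<epsilon> + a/\<epsilon>}"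
    using assms by (intro integrable_integral integrable_fast) auto
  from has_integral_stretch_real[OF this, of "1 / \<epsilon>"]
  have "((\<lambda>s. f (s / \<epsilon>) t x) has_integral \<epsilon> *\<^sub>R integral {a/\<epsilon>..h/\<epsilon> + a/\<epsilon>} (\<lambda>s. f s t x))
      ((\<lambda>s. s / (1 / \<epsilon>)) ` {a/\<epsilon>..h/\<epsilon> + a/\<epsilon>})"
    using assms by simp
  moreover have "(\<lambda>s. s / (1 / \<epsilon>)) ` {a/\<epsilon>..h/\<epsilon> + a/\<epsilon>} = {a..a + h}"
    using assms by (subst image_divide_atLeastAtMost) (simp_all add: field_simps)
  ultimately show ?thesis
    using assms by (simp add: time_mean_def)
qed

text \<open>The window is cut into pieces of length \<open>h\<close>, and on each the slow time and
  the state are frozen at the left endpoint. The threshold is chosen before \<open>s0\<close> and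
  \<open>w\<close>, as later all windows must share it.\<close>

lemma averaging_integral:
  assumes \<kappa>: "\<kappa> > 0" and S: "S > 0"
  shows "\<exists>\<epsilon>0>0. \<forall>\<epsilon> s0 w t. 0 < \<epsilon> \<longrightarrow> \<epsilon> < \<epsilon>0 \<longrightarrow> s0 \<ge> 0 \<longrightarrow>
      solution_on (averaged f) s0 (w s0) {s0..} w \<longrightarrow> (\<forall>t\<ge>s0. norm (w t) \<le> r) \<longrightarrow>
      t \<in> {s0..s0 + S} \<longrightarrow>
      norm (integral {s0..t} (\<lambda>s. f (s / \<epsilon>) s (w s) - averaged f s (w s))) \<le> \<kappa>"
proof -
  \<comment> \<open>Each piece will cost \<open>5 * \<eta> * h\<close>, and at most
    \<open>S / h\<close> full pieces fit, so they use up \<open>\<kappa> / 2\<close>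
    altogether.\<close>
  define \<eta> where "\<eta> = \<kappa> / (10 * S)"
  have \<eta>: "\<eta> > 0" using \<kappa> S by (simp add: \<eta>_def)
  obtain d where d: "d > 0" "\<And>\<tau> t s x. \<tau> \<ge> 0 \<Longrightarrow> t \<ge> 0 \<Longrightarrow> s \<ge> 0 \<Longrightarrow> norm x \<le> r \<Longrightarrow>
      \<bar>t - s\<bar> < d \<Longrightarrow> norm (f \<tau> t x - f \<tau> s x) \<le> \<eta>"
    using equicont[OF \<eta>] by blast
  \<comment> \<open>The three bounds control, in this order, the change in slow time, the change of
    state (\<open>w\<close> moves by at most \<open>M * h\<close> on a piece), and the contribution
    of the incomplete last piece.\<close>
  define h where "h = min (d / 2) (min (\<eta> / (L * M)) (\<kappa> / (4 * M)))"
  have h: "h > 0" "h < d" "L * (M * h) \<le> \<eta>" "2 * M * h \<le> \<kappa> / 2"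
  proof -
    show "h > 0" "h < d" using d(1) \<eta> L M \<kappa> by (auto simp: h_def)
    have "h \<le> \<eta> / (L * M)" "h \<le> \<kappa> / (4 * M)" by (auto simp: h_def)
    then show "L * (M * h) \<le> \<eta>" "2 * M * h \<le> \<kappa> / 2"
      using L M by (simp_all add: field_simps)
  qed
  obtain T0 where T0: "\<And>T \<tau> t x. T \<ge> T0 \<Longrightarrow> \<tau> \<ge> 0 \<Longrightarrow> t \<ge> 0 \<Longrightarrow> norm x \<le> r \<Longrightarrow>
      norm (time_mean f T \<tau> t x - averaged f t x) < \<eta>"
    using unif \<eta> unfolding uniform_limit_iff eventually_at_top_linorder dist_norm by fastforce
  \<comment> \<open>This makes \<open>h / \<epsilon>\<close> at least \<open>T0\<close>; the maximum
    with 1 guards against a nonpositive \<open>T0\<close>.\<close>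
  define \<epsilon>0 where "\<epsilon>0 = h / max T0 1"
  have \<epsilon>0: "\<epsilon>0 > 0" using h by (simp add: \<epsilon>0_def)
  show ?thesis
  proof (intro exI[of _ \<epsilon>0] conjI allI impI \<epsilon>0)
    fix \<epsilon> s0 w t
    assume \<epsilon>: "0 < \<epsilon>" "\<epsilon> < \<epsilon>0" and s0: "0 \<le> s0"
      and w: "solution_on (averaged f) s0 (w s0) {s0..} w"
      and wr: "\<forall>t\<ge>s0. norm (w t) \<le> r" and t: "t \<in> {s0..s0 + S}"
    have hT: "h / \<epsilon> \<ge> T0"
    proof -
      have "\<epsilon> * max T0 1 < h"
        using \<epsilon>(2) by (simp add: \<epsilon>0_def pos_less_divide_eq)
      moreover have "\<epsilon> * T0 \<le> \<epsilon> * max T0 1" using \<epsilon>(1) by simp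
      ultimately have "T0 * \<epsilon> \<le> h" by (simp only: mult.commute)
      then show ?thesis using \<epsilon>(1) by (simp add: pos_le_divide_eq)
    qed
    define G where "G s = f (s / \<epsilon>) s (w s) - averaged f s (w s)" for s
    have cw: "continuous_on {a..b} w" if "a \<ge> s0" for a b
      by (rule continuous_on_subset[OF solution_on_continuous[OF w]]) (use that in auto)
    \<comment> \<open>Since \<open>w\<close> is an antiderivative, the averaged field is integrable
      along \<open>w\<close> without a separate continuity argument.\<close>
    have ftc: "((\<lambda>s. averaged f s (w s)) has_integral w b - w a) {a..b}" if "s0 \<le> a" "a \<le> b" for a b
      using that by (intro fundamental_theorem_of_calculus solution_on_halflineD[OF w]) auto
    have fi: "(\<lambda>s. f (s / \<epsilon>) s (w s)) integrable_on {a..b}" if "s0 \<le> a" for a b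
      using that s0 \<epsilon> wr
      by (intro integrable_continuous_real continuous_on_f cw continuous_intros) auto
    have Gi: "G integrable_on {a..b}" if "s0 \<le> a" "a \<le> b" for a b
      unfolding G_def using that by (intro integrable_diff fi has_integral_integrable[OF ftc])
    have wlip: "norm (w b - w a) \<le> M * (b - a)" if "s0 \<le> a" "a \<le> b" for a b
    proof -
      have "norm (integral {a..b} (\<lambda>s. averaged f s (w s))) \<le> M * (b - a)"
        by (rule norm_integral_le_const[OF has_integral_integrable[OF ftc]])
          (use that s0 wr norm_averaged_le in auto)
      then show ?thesis using integral_unique[OF ftc[OF that]] by simp
    qed
    have G2M: "norm (G s) \<le> 2 * M" if "s \<ge> s0" for s
      unfolding G_def
      using norm_triangle_ineq4[of "f (s / \<epsilon>) s (w s)" "averaged f s (w s)"]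
        bound[of "s / \<epsilon>" s "w s"] norm_averaged_le[of s "w s"] that s0 \<epsilon> wr by auto
    have piece: "norm (integral {a..a + h} G) \<le> 5 * \<eta> * h" if a: "a \<ge> s0" for a
    proof -
      \<comment> \<open>The integrand with frozen slow arguments. The cost \<open>5 * \<eta>\<close>
        per unit of time consists of \<open>2 * \<eta>\<close> each for freezing \<open>f\<close>
        and the averaged field, and \<open>\<eta>\<close> for the mean of \<open>B\<close>.\<close>
      define B where "B s = f (s / \<epsilon>) a (w a) - averaged f a (w a)" for s
      have near: "norm (f \<tau> s (w s) - f \<tau> a (w a)) \<le> 2 * \<eta>" if s: "s \<in> {a..a + h}" "\<tau> \<ge> 0" for s \<tau>
      proof -
        have "norm (f \<tau> s (w s) - f \<tau> a (w s)) \<le> \<eta>"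
          using s a s0 wr h by (intro d(2)) auto
        moreover have "norm (f \<tau> a (w s) - f \<tau> a (w a)) \<le> L * norm (w s - w a)"
          using s a s0 wr by (intro lip) auto
        moreover have "L * norm (w s - w a) \<le> L * (M * h)"
          using wlip[of a s] a s L M by (intro mult_left_mono order_trans[OF wlip]) auto
        ultimately show ?thesis
          using h(3) norm_triangle_ineq[of "f \<tau> s (w s) - f \<tau> a (w s)" "f \<tau> a (w s) - f \<tau> a (w a)"]
          by simp
      qed
      have B: "(B has_integral h *\<^sub>R time_mean f (h / \<epsilon>) (a / \<epsilon>) a (w a) - h *\<^sub>R averaged f a (w a)) {a..a + h}"
        unfolding B_def
        using integral_rescaled[of \<epsilon> h a a "w a"] has_integral_const_real[of "averaged f a (w a)" a "a + h"]
          \<epsilon> h s0 a wr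
        by (intro has_integral_diff) auto
      have "norm (integral {a..a + h} B) = h * norm (time_mean f (h / \<epsilon>) (a / \<epsilon>) a (w a) - averaged f a (w a))"
        using integral_unique[OF B] h by (simp add: scaleR_diff_right[symmetric])
      also have "\<dots> \<le> h * \<eta>"
        using T0[OF hT, of "a / \<epsilon>" a "w a"] a s0 \<epsilon> wr h by (intro mult_left_mono) auto
      finally have 1: "norm (integral {a..a + h} B) \<le> \<eta> * h" by (simp add: mult.commute)
      have GB: "(\<lambda>s. G s - B s) integrable_on {a..a + h}"
        using Gi[of a "a + h"] a h B by (intro integrable_diff) auto
      have "norm (integral {a..a + h} (\<lambda>s. G s - B s)) \<le> (4 * \<eta>) * (a + h - a)"
      proof (rule norm_integral_le_const[OF GB])
        fix s assume s: "s \<in> {a..a + h}"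
        have "norm (averaged f s (w s) - averaged f a (w a)) \<le> 2 * \<eta>"
          using near[OF s] s a s0 wr by (intro norm_averaged_diff_le) auto
        then show "norm (G s - B s) \<le> 4 * \<eta>"
          using near[OF s, of "s / \<epsilon>"] s a s0 \<epsilon>
            norm_triangle_ineq4[of "f (s / \<epsilon>) s (w s) - f (s / \<epsilon>) a (w a)" "averaged f s (w s) - averaged f a (w a)"]
          by (simp add: G_def B_def algebra_simps)
      qed (use h in auto)
      moreover have "integral {a..a + h} G = integral {a..a + h} (\<lambda>s. G s - B s) + integral {a..a + h} B"
        using integral_add[OF GB has_integral_integrable[OF B]] by simp
      ultimately show ?thesis
        using 1 norm_triangle_ineq[of "integral {a..a + h} (\<lambda>s. G s - B s)" "integral {a..a + h} B"]
        by simp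
    qed
    have comb: "integral {s0..b} G + integral {b..c} G = integral {s0..c} G" if "s0 \<le> b" "b \<le> c" for b c
      using that by (intro Henstock_Kurzweil_Integration.integral_combine Gi) auto
    have grid: "norm (integral {s0..s0 + real k * h} G) \<le> real k * (5 * \<eta> * h)" for k
    proof (induction k)
      case (Suc k)
      have "integral {s0..s0 + real (Suc k) * h} G
          = integral {s0..s0 + real k * h} G + integral {s0 + real k * h..s0 + real k * h + h} G"
        using comb[of "s0 + real k * h" "s0 + real k * h + h"] h by (simp add: algebra_simps)
      then show ?case
        using Suc piece[of "s0 + real k * h"] h
          norm_triangle_ineq[of "integral {s0..s0 + real k * h} G" "integral {s0 + real k * h..s0 + real k * h + h} G"]
        by (simp add: algebra_simps)
    qed simp
    \<comment> \<open>The number of full pieces before \<open>t\<close>; the remainder from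
      \<open>b\<close> to \<open>t\<close> is at most \<open>h\<close> long, and the crude bound
      \<open>2 * M\<close> suffices there.\<close>
    define k where "k = nat \<lfloor>(t - s0) / h\<rfloor>"
    define b where "b = s0 + real k * h"
    have "real k \<le> (t - s0) / h" "(t - s0) / h < real k + 1"
      using t h by (auto simp: k_def)
    then have b: "s0 \<le> b" "b \<le> t" "t - b \<le> h" and kS: "real k * h \<le> S"
      using t h by (auto simp: b_def field_simps)
    have "norm (integral {s0..b} G) \<le> real k * (5 * \<eta> * h)"
      unfolding b_def by (rule grid)
    also have "\<dots> \<le> 5 * \<eta> * S"
      using mult_left_mono[OF kS, of "5 * \<eta>"] \<eta> by (simp add: algebra_simps)
    also have "\<dots> = \<kappa> / 2" using S by (simp add: \<eta>_def)
    finally have 1: "norm (integral {s0..b} G) \<le> \<kappa> / 2" .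
    have "norm (integral {b..t} G) \<le> 2 * M * (t - b)"
      by (rule norm_integral_le_const[OF Gi]) (use b G2M in auto)
    also have "\<dots> \<le> 2 * M * h" using b M by (intro mult_left_mono) auto
    finally have 2: "norm (integral {b..t} G) \<le> \<kappa> / 2" using h(4) by simp
    show "norm (integral {s0..t} (\<lambda>s. f (s / \<epsilon>) s (w s) - averaged f s (w s))) \<le> \<kappa>"
      using 1 2 comb[OF b(1,2)] norm_triangle_ineq[of "integral {s0..b} G" "integral {b..t} G"]
      by (simp add: G_def[symmetric])
  qed
qed

(* Composing with the projection onto the ball makes the field globally bounded and Lipschitz, so
   that solutions exist on the whole half-line; that they stay in the ball is shown afterwards. *)
definition trunc :: "'a \<Rightarrow> 'a" where
  "trunc = closest_point (cball 0 r)"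

lemma norm_trunc: "norm (trunc x) \<le> r"
  using closest_point_in_set[of "cball 0 r" x] r by (simp add: trunc_def)

lemma trunc_id: "norm x \<le> r \<Longrightarrow> trunc x = x"
  by (simp add: trunc_def closest_point_self)

lemma norm_trunc_diff_le: "norm (trunc x - trunc y) \<le> norm (x - y)"
  using closest_point_lipschitz[of "cball 0 r" x y] r by (simp add: trunc_def dist_norm)

lemma continuous_on_trunc: "continuous_on S trunc"
  using r by (auto simp: trunc_def intro!: continuous_on_closest_point)

lemma truncated_solution_exists:
  assumes "\<epsilon> > 0"
  shows "\<exists>x. solution_on (\<lambda>t x. f (t / \<epsilon>) t (trunc x)) 0 x0 {0..} x"
proof (rule global_solution_exists)
  have "continuous_on ({0..} \<times> UNIV) (\<lambda>p. f (fst p / \<epsilon>) (fst p) (trunc (snd p)))"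
    using assms norm_trunc
    by (intro continuous_on_f continuous_intros continuous_on_compose2[OF continuous_on_trunc[of UNIV]]) auto
  then show "continuous_on ({0..} \<times> UNIV) (\<lambda>(t, x). f (t / \<epsilon>) t (trunc x))"
    by (simp add: case_prod_unfold)
  fix t :: real and x y assume t: "0 \<le> t"
  show "norm (f (t / \<epsilon>) t (trunc x)) \<le> M"
    using assms t norm_trunc by (intro bound) auto
  have "norm (f (t / \<epsilon>) t (trunc x) - f (t / \<epsilon>) t (trunc y)) \<le> L * norm (trunc x - trunc y)"
    using assms t norm_trunc by (intro lip) auto
  also have "\<dots> \<le> L * norm (x - y)"
    using norm_trunc_diff_le L by (intro mult_left_mono) auto
  finally show "norm (f (t / \<epsilon>) t (trunc x) - f (t / \<epsilon>) t (trunc y)) \<le> L * norm (x - y)" .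
qed (rule L)

text \<open>The derivative of \<open>X - w\<close> splits into a part controlled by the Lipschitz
  bound and the oscillating part estimated in \<open>averaging_integral\<close>. Only
  \<open>w\<close> is required to stay in the ball; the truncation takes care of \<open>X\<close>,
  which starts at time 0 and so enters the window with its true fast phase.\<close>

lemma averaging_window:
  assumes \<kappa>: "\<kappa> > 0" and S: "S > 0"
  shows "\<exists>\<epsilon>0>0. \<forall>\<epsilon> s0 w X x0 t. 0 < \<epsilon> \<longrightarrow> \<epsilon> < \<epsilon>0 \<longrightarrow> s0 \<ge> 0 \<longrightarrow>
      solution_on (averaged f) s0 (w s0) {s0..} w \<longrightarrow> (\<forall>t\<ge>s0. norm (w t) \<le> r) \<longrightarrow>
      solution_on (\<lambda>t x. f (t / \<epsilon>) t (trunc x)) 0 x0 {0..} X \<longrightarrow> X s0 = w s0 \<longrightarrow>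
      t \<in> {s0..s0 + S} \<longrightarrow> norm (X t - w t) \<le> \<kappa>"
proof -
  \<comment> \<open>Dividing by the largest Gronwall factor on the window compensates for its
    amplification of the error.\<close>
  define \<kappa>' where "\<kappa>' = \<kappa> / exp (L * S)"
  have "\<kappa>' > 0" using \<kappa> by (simp add: \<kappa>'_def)
  from averaging_integral[OF this S] obtain \<epsilon>0 where "\<epsilon>0 > 0"
    and close: "\<And>\<epsilon> s0 w t. 0 < \<epsilon> \<Longrightarrow> \<epsilon> < \<epsilon>0 \<Longrightarrow> s0 \<ge> 0 \<Longrightarrow>
      solution_on (averaged f) s0 (w s0) {s0..} w \<Longrightarrow> (\<forall>t\<ge>s0. norm (w t) \<le> r) \<Longrightarrow>
      t \<in> {s0..s0 + S} \<Longrightarrow>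
      norm (integral {s0..t} (\<lambda>s. f (s / \<epsilon>) s (w s) - averaged f s (w s))) \<le> \<kappa>'"
    by blast
  show ?thesis
  proof (intro exI[of _ \<epsilon>0] conjI allI impI \<open>\<epsilon>0 > 0\<close>)
    fix \<epsilon> s0 w X x0 t
    assume \<epsilon>: "0 < \<epsilon>" "\<epsilon> < \<epsilon>0" and s0: "0 \<le> s0"
      and w: "solution_on (averaged f) s0 (w s0) {s0..} w"
      and wr: "\<forall>t\<ge>s0. norm (w t) \<le> r"
      and X: "solution_on (\<lambda>t x. f (t / \<epsilon>) t (trunc x)) 0 x0 {0..} X"
      and eq: "X s0 = w s0" and t: "t \<in> {s0..s0 + S}"
    let ?u = "\<lambda>s. X s - w s"
    let ?p = "\<lambda>s. f (s / \<epsilon>) s (trunc (X s)) - f (s / \<epsilon>) s (w s)"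
    let ?G = "\<lambda>s. f (s / \<epsilon>) s (w s) - averaged f s (w s)"
    have "norm (?u t) \<le> (norm (?u s0) + \<kappa>') * exp (L * (t - s0))"
    proof (rule perturbed_gronwall)
      show "s0 \<le> t" "0 \<le> L" using t L by auto
      have "(\<lambda>s. f (s / \<epsilon>) s (w s)) integrable_on {s0..t}"
        using s0 \<epsilon> wr continuous_on_subset[OF solution_on_continuous[OF w], of "{s0..t}"]
        by (intro integrable_continuous_real continuous_on_f continuous_intros) auto
      moreover have "((\<lambda>s. averaged f s (w s)) has_integral w t - w s0) {s0..t}"
        using t by (intro fundamental_theorem_of_calculus solution_on_halflineD[OF w]) auto
      ultimately show "?G integrable_on {s0..t}"
        by (intro integrable_diff) auto
    next
      fix s assume s: "s \<in> {s0..t}"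
      have "(?u has_vector_derivative f (s / \<epsilon>) s (trunc (X s)) - averaged f s (w s)) (at s within {s0..t})"
        using s s0 by (intro derivative_intros solution_on_halflineD[OF w] solution_on_halflineD[OF X]) auto
      then show "(?u has_vector_derivative ?p s + ?G s) (at s within {s0..t})" by simp
      have "norm (?p s) \<le> L * norm (trunc (X s) - w s)"
        using s s0 \<epsilon> wr norm_trunc by (intro lip) auto
      also have "\<dots> \<le> L * norm (?u s)"
        using norm_trunc_diff_le[of "X s" "w s"] trunc_id[of "w s"] wr s L by (intro mult_left_mono) auto
      finally show "norm (?p s) \<le> L * norm (?u s)" .
      show "norm (integral {s0..s} ?G) \<le> \<kappa>'"
        using close[OF \<epsilon> s0 w wr] s t by auto
    qed
    also have "\<dots> \<le> \<kappa>' * exp (L * S)"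
      using t L \<open>\<kappa>' > 0\<close> by (simp add: eq)
    finally show "norm (X t - w t) \<le> \<kappa>" by (simp add: \<kappa>'_def)
  qed
qed

end

subsection \<open>Averaging on the half-line\<close>

text \<open>The level set is compact and nonempty, so it has a least element; a larger value before
  it would produce a still earlier crossing.\<close>

lemma first_crossing:
  fixes v :: "real \<Rightarrow> real"
  assumes cont: "continuous_on {a..b} v" and ab: "a \<le> b" and va: "v a \<le> c" and vb: "c \<le> v b"
  shows "\<exists>t\<in>{a..b}. v t = c \<and> (\<forall>s\<in>{a..t}. v s \<le> c)"
proof -
  define A where "A = {t \<in> {a..b}. v t = c}"
  have "A \<noteq> {}"
    using IVT'[of v a c b] assms by (auto simp: A_def)
  moreover have "compact A"
    using continuous_closed_preimage_constant[OF cont, of c]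
    by (auto simp: A_def compact_eq_bounded_closed intro: bounded_subset[of "{a..b}"])
  ultimately obtain t where t: "t \<in> A" "\<And>s. s \<in> A \<Longrightarrow> t \<le> s"
    using compact_attains_inf[of A] by auto
  have "v s \<le> c" if s: "s \<in> {a..t}" for s
  proof (rule ccontr)
    assume "\<not> v s \<le> c"
    then obtain s' where "a \<le> s'" "s' \<le> s" "v s' = c"
      using IVT'[of v a c s] continuous_on_subset[OF cont, of "{a..s}"] s t(1) va
      by (auto simp: A_def)
    moreover from this have "t \<le> s'"
      using t(2)[of s'] s t(1) by (auto simp: A_def)
    ultimately have "s' = s" using s by auto
    then show False using \<open>v s' = c\<close> \<open>\<not> v s \<le> c\<close> by simp
  qed
  then show ?thesis using t(1) by (auto simp: A_def)
qed

context averaging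
begin

text \<open>Attraction says nothing before \<open>s0 + s1\<close>, where Gronwall's inequality takes
  over. Its Lipschitz constant is valid in the ball only, so the argument stops at the first time
  the distance equals \<open>\<rho>\<close>: until then \<open>w\<close> is in the ball, and the
  bound obtained is strictly below \<open>\<rho>\<close>, a contradiction.\<close>

lemma averaged_solutions_stay_close:
  assumes Z: "solution_on (averaged f) 0 x0 {0..} Z" and ZR: "\<And>t. t \<ge> 0 \<Longrightarrow> norm (Z t) \<le> R"
    and R: "R + \<rho> \<le> r" and \<rho>: "\<rho> > 0" and s0: "s0 \<ge> 0" and s1: "s1 \<ge> 0"
    and w: "solution_on (averaged f) s0 (w s0) {s0..} w"
    and init: "norm (Z s0 - w s0) * exp (L * s1) < \<rho>"
    and attract: "\<And>t. t \<ge> s0 + s1 \<Longrightarrow> norm (Z t - w t) \<le> \<rho>"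
    and t: "t \<ge> s0"
  shows "norm (Z t - w t) \<le> \<rho>"
proof (rule ccontr)
  assume far: "\<not> norm (Z t - w t) \<le> \<rho>"
  then have ts1: "t < s0 + s1" using attract[of t] by linarith
  have "norm (Z s0 - w s0) \<le> norm (Z s0 - w s0) * exp (L * s1)"
    using L s1 by (simp add: mult_le_cancel_left1)
  then have le: "norm (Z s0 - w s0) \<le> \<rho>" using init by linarith
  have "continuous_on {s0..t} Z" "continuous_on {s0..t} w"
    by (rule continuous_on_subset[OF solution_on_continuous[OF Z]]
        continuous_on_subset[OF solution_on_continuous[OF w]]; use s0 in auto)+
  then have "continuous_on {s0..t} (\<lambda>s. norm (Z s - w s))"
    by (intro continuous_intros)
  from first_crossing[OF this t le] far obtain t1 where t1: "t1 \<in> {s0..t}" "norm (Z t1 - w t1) = \<rho>"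
    and upto: "\<And>s. s \<in> {s0..t1} \<Longrightarrow> norm (Z s - w s) \<le> \<rho>"
    by auto
  have "norm (Z t1 - w t1) \<le> norm (Z s0 - w s0) * exp (L * (t1 - s0))"
  proof (rule gronwall)
    show "s0 \<le> t1" "0 \<le> L" using t1 L by auto
    fix s assume s: "s \<in> {s0..t1}"
    show "((\<lambda>s. Z s - w s) has_vector_derivative averaged f s (Z s) - averaged f s (w s)) (at s within {s0..t1})"
      using s s0 by (intro derivative_intros solution_on_halflineD[OF Z] solution_on_halflineD[OF w]) auto
    have "norm (Z s) \<le> R" using s s0 ZR by auto
    moreover have "norm (w s) \<le> norm (Z s) + norm (Z s - w s)"
      using norm_triangle_ineq4[of "Z s" "Z s - w s"] by simp
    ultimately show "norm (averaged f s (Z s) - averaged f s (w s)) \<le> L * norm (Z s - w s)"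
      using upto[OF s] s s0 R \<rho> by (intro averaged_lip) auto
  qed
  also have "\<dots> \<le> norm (Z s0 - w s0) * exp (L * s1)"
    using t1(1) ts1 L by (intro mult_left_mono) auto
  finally show False using init t1(2) by linarith
qed

lemma averaging_halfline:
  assumes lipschitz: "locally_lipschitz_from 0 (averaged f)"
    and stable: "uniformly_asymptotically_stable (averaged f) 0 x0"
    and ZR: "\<And>t. t \<ge> 0 \<Longrightarrow> norm (sol (averaged f) 0 x0 t) \<le> R"
    and \<sigma>: "\<sigma> > 0" and R: "R + \<sigma> \<le> r"
  shows "\<exists>\<epsilon>0>0. \<forall>\<epsilon>. 0 < \<epsilon> \<and> \<epsilon> < \<epsilon>0 \<longrightarrow>
    (\<exists>X. solution_on (\<lambda>t x. f (t / \<epsilon>) t x) 0 x0 {0..} X \<and>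
      (\<forall>t\<ge>0. norm (X t - sol (averaged f) 0 x0 t) \<le> \<sigma>))"
proof -
  define Z where "Z = sol (averaged f) 0 x0"
  have Z: "solution_on (averaged f) 0 x0 {0..} Z"
    unfolding Z_def using stable
    by (intro solution_on_sol lipschitz) (simp add: uniformly_asymptotically_stable_def)
  obtain \<mu> where \<mu>: "\<mu> > 0" and attr: "\<And>\<sigma>. 0 < \<sigma> \<Longrightarrow> \<sigma> \<le> \<mu> \<Longrightarrow>
      \<exists>s\<sigma>\<ge>0. \<forall>s0 z0. s0 \<ge> 0 \<and> norm (Z s0 - z0) \<le> \<mu> \<longrightarrow>
        sol_ivl (averaged f) s0 z0 = {s0..} \<and>
        (\<forall>t\<ge>s0 + s\<sigma>. norm (Z t - sol (averaged f) s0 z0 t) \<le> \<sigma>)"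
    using stable unfolding uniformly_asymptotically_stable_def Z_def by blast
  \<comment> \<open>Room for excursions of the averaged solution; the other half of
    \<open>\<sigma>\<close> is left for the averaging error, and \<open>\<mu>\<close> caps the
    levels at which stability may be invoked.\<close>
  define \<rho> where "\<rho> = min (\<sigma> / 2) \<mu>"
  have \<rho>: "\<rho> > 0" "\<rho> \<le> \<mu>" "2 * \<rho> \<le> \<sigma>" using \<sigma> \<mu> by (auto simp: \<rho>_def)
  obtain s1 where s1: "s1 \<ge> 0" and attr1: "\<And>s0 z0 t. s0 \<ge> 0 \<Longrightarrow> norm (Z s0 - z0) \<le> \<mu> \<Longrightarrow>
      t \<ge> s0 + s1 \<Longrightarrow> norm (Z t - sol (averaged f) s0 z0 t) \<le> \<rho>"
    using attr[OF \<rho>(1,2)] by blast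
  \<comment> \<open>The factor 2 makes the initial condition of
    \<open>averaged_solutions_stay_close\<close> strict.\<close>
  define \<delta> where "\<delta> = \<rho> / (2 * exp (L * s1))"
  have \<delta>: "\<delta> > 0" "\<delta> \<le> \<rho>" "\<delta> * exp (L * s1) < \<rho>"
  proof -
    show "\<delta> > 0" "\<delta> * exp (L * s1) < \<rho>" using \<rho> by (auto simp: \<delta>_def)
    moreover have "\<delta> * 1 \<le> \<delta> * exp (L * s1)"
      using \<open>\<delta> > 0\<close> L s1 by (intro mult_left_mono) auto
    ultimately show "\<delta> \<le> \<rho>" by linarith
  qed
  \<comment> \<open>Stability is used a second time, at the finer level \<open>\<delta> / 2\<close>,
    to contract over one window; \<open>s1\<close> served only to fix
    \<open>\<delta>\<close>.\<close>
  obtain s2 where s2: "s2 \<ge> 0" and attr2: "\<And>s0 z0 t. s0 \<ge> 0 \<Longrightarrow> norm (Z s0 - z0) \<le> \<mu> \<Longrightarrow>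
      sol_ivl (averaged f) s0 z0 = {s0..}"
      "\<And>s0 z0 t. s0 \<ge> 0 \<Longrightarrow> norm (Z s0 - z0) \<le> \<mu> \<Longrightarrow>
      t \<ge> s0 + s2 \<Longrightarrow> norm (Z t - sol (averaged f) s0 z0 t) \<le> \<delta> / 2"
    using attr[of "\<delta> / 2"] \<delta> \<rho> by fastforce
  \<comment> \<open>Adding 1 keeps the window length positive even if \<open>s2\<close> is
    0.\<close>
  define S where "S = s2 + 1"
  have S: "S > 0" using s2 by (simp add: S_def)
  have "\<delta> / 2 > 0" using \<delta> by simp
  from averaging_window[OF this S] obtain \<epsilon>0 where "\<epsilon>0 > 0"
    and window: "\<And>\<epsilon> s0 w X x0 t. 0 < \<epsilon> \<Longrightarrow> \<epsilon> < \<epsilon>0 \<Longrightarrow> s0 \<ge> 0 \<Longrightarrow>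
      solution_on (averaged f) s0 (w s0) {s0..} w \<Longrightarrow> (\<forall>t\<ge>s0. norm (w t) \<le> r) \<Longrightarrow>
      solution_on (\<lambda>t x. f (t / \<epsilon>) t (trunc x)) 0 x0 {0..} X \<Longrightarrow> X s0 = w s0 \<Longrightarrow>
      t \<in> {s0..s0 + S} \<Longrightarrow> norm (X t - w t) \<le> \<delta> / 2"
    by blast
  have "\<exists>X. solution_on (\<lambda>t x. f (t / \<epsilon>) t x) 0 x0 {0..} X \<and> (\<forall>t\<ge>0. norm (X t - Z t) \<le> \<sigma>)"
    if \<epsilon>: "0 < \<epsilon>" "\<epsilon> < \<epsilon>0" for \<epsilon>
  proof -
    obtain X where X: "solution_on (\<lambda>t x. f (t / \<epsilon>) t (trunc x)) 0 x0 {0..} X"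
      using truncated_solution_exists[OF \<epsilon>(1)] by blast
    have step: "norm (X t - Z t) \<le> \<sigma> \<and> (t = s0 + S \<longrightarrow> norm (X t - Z t) \<le> \<delta>)"
      if s0: "s0 \<ge> 0" and near: "norm (X s0 - Z s0) \<le> \<delta>" and t: "t \<in> {s0..s0 + S}" for s0 t
    proof -
      define w where "w = sol (averaged f) s0 (X s0)"
      have init: "norm (Z s0 - X s0) \<le> \<mu>"
        using near \<delta>(2) \<rho>(2) by (simp add: norm_minus_commute)
      have wX: "solution_on (averaged f) s0 (X s0) {s0..} w"
        unfolding w_def
        by (intro solution_on_sol locally_lipschitz_from_mono[OF lipschitz s0] attr2(1) s0 init)
      then have w0: "w s0 = X s0" by (rule solution_onD(4))
      with wX have w: "solution_on (averaged f) s0 (w s0) {s0..} w" by simp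
      have "norm (Z s0 - w s0) * exp (L * s1) \<le> \<delta> * exp (L * s1)"
        using near by (intro mult_right_mono) (simp_all add: w0 norm_minus_commute)
      then have near': "norm (Z s0 - w s0) * exp (L * s1) < \<rho>"
        using \<delta>(3) by linarith
      have close: "norm (Z t - w t) \<le> \<rho>" if "t \<ge> s0" for t
      proof (rule averaged_solutions_stay_close[OF Z _ _ \<rho>(1) s0 s1 w near' _ that])
        show "norm (Z t) \<le> R" if "t \<ge> 0" for t
          using ZR[OF that] by (simp add: Z_def)
        show "norm (Z t - w t) \<le> \<rho>" if "t \<ge> s0 + s1" for t
          unfolding w_def by (rule attr1[OF s0 init that])
        show "R + \<rho> \<le> r" using R \<rho> by linarith
      qed
      have wr: "\<forall>t\<ge>s0. norm (w t) \<le> r"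
      proof (intro allI impI)
        fix t assume t: "t \<ge> s0"
        have "norm (w t) \<le> norm (Z t) + norm (Z t - w t)"
          using norm_triangle_ineq4[of "Z t" "Z t - w t"] by simp
        then show "norm (w t) \<le> r"
          using close[OF t] ZR[of t] t s0 R \<rho> by (simp add: Z_def)
      qed
      have xw: "norm (X t - w t) \<le> \<delta> / 2"
        using window[OF \<epsilon> s0 w wr X w0[symmetric] t] .
      have tri: "norm (X t - Z t) \<le> norm (X t - w t) + norm (Z t - w t)"
        using norm_triangle_ineq4[of "X t - w t" "Z t - w t"] by simp
      have "norm (Z t - w t) \<le> \<delta> / 2" if "t = s0 + S"
        using attr2(2)[OF s0 init, of t] that by (simp add: w_def S_def)
      then show ?thesis
        using tri xw close[of t] t \<rho> \<delta> by auto
    qed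
    have grid: "norm (X (real k * S) - Z (real k * S)) \<le> \<delta>" for k
    proof (induction k)
      case 0
      then show ?case using \<delta> solution_onD(4)[OF X] solution_onD(4)[OF Z] by simp
    next
      case (Suc k)
      have "real (Suc k) * S = real k * S + S" by (simp add: algebra_simps)
      then show ?case using step[of "real k * S" "real k * S + S"] Suc S by simp
    qed
    have close: "norm (X t - Z t) \<le> \<sigma>" if t: "t \<ge> 0" for t
    proof -
      define k where "k = nat \<lfloor>t / S\<rfloor>"
      have "real k \<le> t / S" "t / S < real k + 1"
        using t S by (auto simp: k_def)
      then have "t \<in> {real k * S..real k * S + S}"
        using S by (auto simp: field_simps)
      then show ?thesis using step[OF _ grid, of k t] S by simp
    qed
    \<comment> \<open>Being within \<open>\<sigma>\<close> of an orbit bounded by \<open>R\<close>,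
      the curve \<open>X\<close> never meets the truncation and so solves the original
      equation.\<close>
    have "norm (X t) \<le> r" if t: "t \<ge> 0" for t
    proof -
      have "norm (X t) \<le> norm (X t - Z t) + norm (Z t)"
        using norm_triangle_ineq[of "X t - Z t" "Z t"] by simp
      then show ?thesis using close[OF t] ZR[OF t] R by (simp add: Z_def)
    qed
    then have "solution_on (\<lambda>t x. f (t / \<epsilon>) t x) 0 x0 {0..} X"
      using X by (simp add: solution_on_def trunc_id)
    then show ?thesis using close by blast
  qed
  then show ?thesis using \<open>\<epsilon>0 > 0\<close> unfolding Z_def by blast
qed

end

section \<open>Passage from slow to fast time\<close>

lemma solution_on_rescale:
  assumes "solution_on g 0 x0 {0..} x" "\<epsilon> > 0"
  shows "solution_on (\<lambda>\<tau> y. \<epsilon> *\<^sub>R g (\<epsilon> * \<tau>) y) 0 x0 {0..} (\<lambda>\<tau>. x (\<epsilon> * \<tau>))"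
  unfolding solution_on_def
proof (intro conjI ballI)
  fix \<tau> :: real assume "\<tau> \<in> {0..}"
  then have "(x has_vector_derivative g (\<epsilon> * \<tau>) (x (\<epsilon> * \<tau>))) (at (\<epsilon> * \<tau>) within {0..})"
    using solution_onD(5)[OF assms(1)] assms(2) by simp
  moreover have "(\<lambda>\<tau>. \<epsilon> * \<tau>) ` {0..} \<subseteq> {0..}" using assms(2) by auto
  ultimately have "(x has_vector_derivative g (\<epsilon> * \<tau>) (x (\<epsilon> * \<tau>)))
      (at (\<epsilon> * \<tau>) within (\<lambda>\<tau>. \<epsilon> * \<tau>) ` {0..})"
    by (rule has_vector_derivative_within_subset)
  moreover have "((\<lambda>\<tau>. \<epsilon> * \<tau>) has_vector_derivative \<epsilon>) (at \<tau> within {0..})"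
    by (auto intro!: derivative_eq_intros)
  ultimately show "((\<lambda>\<tau>. x (\<epsilon> * \<tau>)) has_vector_derivative \<epsilon> *\<^sub>R g (\<epsilon> * \<tau>) (x (\<epsilon> * \<tau>))) (at \<tau> within {0..})"
    using vector_diff_chain_within[of "\<lambda>\<tau>. \<epsilon> * \<tau>" \<epsilon> \<tau> "{0..}" x] by (simp add: o_def)
qed (use solution_onD[OF assms(1)] in auto)

lemma locally_lipschitz_from_rescale:
  assumes "locally_lipschitz_from 0 g" "\<epsilon> > 0"
  shows "locally_lipschitz_from 0 (\<lambda>\<tau> y. \<epsilon> *\<^sub>R g (\<epsilon> * \<tau>) y)"
  unfolding locally_lipschitz_from_def
proof (intro allI impI)
  fix r :: real assume "r > 0"
  then obtain L where L: "L \<ge> 0" "\<And>t x y. t \<ge> 0 \<Longrightarrow> norm x \<le> r \<Longrightarrow> norm y \<le> r \<Longrightarrow>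
      norm (g t x - g t y) \<le> L * norm (x - y)"
    using assms(1) unfolding locally_lipschitz_from_def by meson
  have "norm (\<epsilon> *\<^sub>R g (\<epsilon> * t) x - \<epsilon> *\<^sub>R g (\<epsilon> * t) y) \<le> (\<epsilon> * L) * norm (x - y)"
    if "t \<ge> 0" "norm x \<le> r" "norm y \<le> r" for t x y
    using L(2)[of "\<epsilon> * t" x y] that assms(2) by (simp add: scaleR_diff_right[symmetric])
  then show "\<exists>L\<ge>0. \<forall>t\<ge>0. \<forall>x y. norm x \<le> r \<longrightarrow> norm y \<le> r \<longrightarrow>
      norm (\<epsilon> *\<^sub>R g (\<epsilon> * t) x - \<epsilon> *\<^sub>R g (\<epsilon> * t) y) \<le> L * norm (x - y)"
    using L(1) assms(2) by (intro exI[of _ "\<epsilon> * L"]) auto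
qed

text \<open>The limit from the right does not see the value at 0; monotonicity bounds that value by
  all later ones. This makes the time term vanish when only the states differ.\<close>

lemma modulus_of_continuity_zero:
  assumes "modulus_of_continuity \<theta>"
  shows "\<theta> 0 = 0"
proof -
  have "\<forall>\<^sub>F y in at_right 0. \<theta> 0 \<le> \<theta> y"
    using assms unfolding modulus_of_continuity_def
    by (intro eventually_at_rightI[of 0 1]) (auto elim!: mono_onD)
  then have "\<theta> 0 \<le> 0"
    using assms unfolding modulus_of_continuity_def by (intro tendsto_lowerbound) auto
  then show ?thesis by simp
qed

lemma modulus_of_continuity_small:
  assumes \<theta>: "modulus_of_continuity \<theta>" and \<eta>: "\<eta> > 0"
  shows "\<exists>d>0. \<forall>y\<ge>0. y < d \<longrightarrow> \<theta> y \<le> ennreal \<eta>"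
proof -
  have "\<forall>\<^sub>F y in at_right 0. \<theta> y < ennreal \<eta>"
    using \<theta> \<eta> unfolding modulus_of_continuity_def by (intro order_tendstoD(2)) auto
  then obtain d where d: "d > 0" "\<And>y. 0 < y \<Longrightarrow> y < d \<Longrightarrow> \<theta> y < ennreal \<eta>"
    unfolding eventually_at_right_field by auto
  have "\<theta> y \<le> ennreal \<eta>" if "y \<ge> 0" "y < d" for y
    using d(2)[of y] modulus_of_continuity_zero[OF \<theta>] that by (cases "y = 0") auto
  then show ?thesis using d(1) by blast
qed

section \<open>Assembly: the hypotheses on balls, the estimate on the half-line, and both time
  scales\<close>

theorem corollary6p4:
  fixes f :: "real \<Rightarrow> real \<Rightarrow> real ^ 'n \<Rightarrow> real ^ 'n"
    and xhat :: "real ^ 'n"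
  assumes bounded_f: "\<And>r. r > 0 \<Longrightarrow>
      bounded ((\<lambda>(\<tau>, t, x). f \<tau> t x) ` ({0..} \<times> {0..} \<times> {x. norm x \<le> r}))"
    and continuous_f: "\<And>r. r > 0 \<Longrightarrow>
      continuous_on ({0..} \<times> {0..} \<times> {x. norm x \<le> r}) (\<lambda>(\<tau>, t, x). f \<tau> t x)"
    and modulus_f: "\<And>r. r > 0 \<Longrightarrow>
      \<exists>\<theta> L. modulus_of_continuity \<theta> \<and> L > 0 \<and>
        (\<forall>\<tau> t1 t2 x1 x2. \<tau> \<ge> 0 \<and> t1 \<ge> 0 \<and> t2 \<ge> 0 \<and> norm x1 \<le> r \<and> norm x2 \<le> r \<longrightarrow>
          ennreal (norm (f \<tau> t1 x1 - f \<tau> t2 x2))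
            \<le> \<theta> \<bar>t1 - t2\<bar> + ennreal (L * norm (x1 - x2)))"
    and average_exists: "\<And>t x. t \<ge> 0 \<Longrightarrow>
      \<exists>l. ((\<lambda>T. time_mean f T 0 t x) \<longlongrightarrow> l) at_top"
    and average_uniform: "\<And>r. r > 0 \<Longrightarrow>
      uniform_limit ({0..} \<times> {0..} \<times> {x. norm x \<le> r})
        (\<lambda>T (\<tau>, t, x). time_mean f T \<tau> t x) (\<lambda>(\<tau>, t, x). averaged f t x) at_top"
    and stable: "uniformly_asymptotically_stable (averaged f) 0 xhat"
    and bounded_orbit: "bounded {sol (averaged f) 0 xhat t | t. t \<ge> 0}"
  shows "\<forall>\<sigma>>0. \<exists>\<epsilon>\<sigma>>0. \<forall>\<epsilon>. 0 < \<epsilon> \<and> \<epsilon> < \<epsilon>\<sigma> \<longrightarrow>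
      (sol_ivl (\<lambda>t x. f (t / \<epsilon>) t x) 0 xhat = {0..} \<and>
       (\<forall>t\<ge>0. norm (sol (\<lambda>t x. f (t / \<epsilon>) t x) 0 xhat t - sol (averaged f) 0 xhat t) \<le> \<sigma>)) \<and>
      (sol_ivl (\<lambda>\<tau> x. \<epsilon> *\<^sub>R f \<tau> (\<epsilon> * \<tau>) x) 0 xhat = {0..} \<and>
       (\<forall>\<tau>\<ge>0. norm (sol (\<lambda>\<tau> x. \<epsilon> *\<^sub>R f \<tau> (\<epsilon> * \<tau>) x) 0 xhat \<tau>
                   - sol (\<lambda>\<tau> z. \<epsilon> *\<^sub>R averaged f (\<epsilon> * \<tau>) z) 0 xhat \<tau>) \<le> \<sigma>))"
proof (intro allI impI)
  fix \<sigma> :: real assume \<sigma>: "\<sigma> > 0"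
  \<comment> \<open>All radii are needed for the local Lipschitz conditions, while the estimate
    itself uses the single radius \<open>R + \<sigma>\<close>.\<close>
  have av: "\<exists>M L. averaging f r M L" if r: "r > 0" for r
  proof -
    obtain M where M: "M > 0" "\<And>p. p \<in> {0..} \<times> {0..} \<times> {x. norm x \<le> r} \<Longrightarrow>
        norm ((\<lambda>(\<tau>, t, x). f \<tau> t x) p) \<le> M"
      using bounded_f[OF r] unfolding bounded_pos by auto
    obtain \<theta> L where \<theta>: "modulus_of_continuity \<theta>" and L: "L > 0"
      and le: "\<And>\<tau> t1 t2 x1 x2. \<tau> \<ge> 0 \<Longrightarrow> t1 \<ge> 0 \<Longrightarrow> t2 \<ge> 0 \<Longrightarrow> norm x1 \<le> r \<Longrightarrow> norm x2 \<le> r \<Longrightarrow>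
          ennreal (norm (f \<tau> t1 x1 - f \<tau> t2 x2)) \<le> \<theta> \<bar>t1 - t2\<bar> + ennreal (L * norm (x1 - x2))"
      using modulus_f[OF r] by metis
    have "averaging f r M L"
    proof
      fix \<tau> t :: real and x y :: "real ^ 'n"
      assume "\<tau> \<ge> 0" "t \<ge> 0" "norm x \<le> r" "norm y \<le> r"
      then have "ennreal (norm (f \<tau> t x - f \<tau> t y)) \<le> ennreal (L * norm (x - y))"
        using le[of \<tau> t t x y] modulus_of_continuity_zero[OF \<theta>] by simp
      then show "norm (f \<tau> t x - f \<tau> t y) \<le> L * norm (x - y)"
        using L by (subst (asm) ennreal_le_iff) auto
    next
      fix \<eta> :: real assume "\<eta> > 0"
      from modulus_of_continuity_small[OF \<theta> this] obtain d where
        d: "d > 0" "\<And>y. y \<ge> 0 \<Longrightarrow> y < d \<Longrightarrow> \<theta> y \<le> ennreal \<eta>" by blast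
      have "norm (f \<tau> t x - f \<tau> s x) \<le> \<eta>"
        if "\<tau> \<ge> 0" "t \<ge> 0" "s \<ge> 0" "norm x \<le> r" "\<bar>t - s\<bar> < d" for \<tau> t s x
      proof -
        have "ennreal (norm (f \<tau> t x - f \<tau> s x)) \<le> ennreal \<eta>"
          using le[of \<tau> t s x x] d(2)[of "\<bar>t - s\<bar>"] that by auto
        then show ?thesis using \<open>\<eta> > 0\<close> by (subst (asm) ennreal_le_iff) auto
      qed
      then show "\<exists>d>0. \<forall>\<tau> t s x. \<tau> \<ge> 0 \<longrightarrow> t \<ge> 0 \<longrightarrow> s \<ge> 0 \<longrightarrow> norm x \<le> r \<longrightarrow>
          \<bar>t - s\<bar> < d \<longrightarrow> norm (f \<tau> t x - f \<tau> s x) \<le> \<eta>"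
        using d(1) by blast
    qed (use r M L continuous_f[OF r] average_uniform[OF r] in auto)
    then show ?thesis by blast
  qed
  have lip_av: "locally_lipschitz_from 0 (averaged f)"
    unfolding locally_lipschitz_from_def
  proof (intro allI impI)
    fix r :: real assume "r > 0"
    then obtain M L where "averaging f r M L" using av by blast
    then interpret averaging f r M L .
    show "\<exists>L\<ge>0. \<forall>t\<ge>0. \<forall>x y. norm x \<le> r \<longrightarrow> norm y \<le> r \<longrightarrow>
        norm (averaged f t x - averaged f t y) \<le> L * norm (x - y)"
      using averaged_lip L by (intro exI[of _ L]) auto
  qed
  have lip_f: "locally_lipschitz_from 0 (\<lambda>t x. f (t / \<epsilon>) t x)" if "\<epsilon> > 0" for \<epsilon>
    unfolding locally_lipschitz_from_def
  proof (intro allI impI)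
    fix r :: real assume "r > 0"
    then obtain M L where "averaging f r M L" using av by blast
    then interpret averaging f r M L .
    show "\<exists>L\<ge>0. \<forall>t\<ge>0. \<forall>x y. norm x \<le> r \<longrightarrow> norm y \<le> r \<longrightarrow>
        norm (f (t / \<epsilon>) t x - f (t / \<epsilon>) t y) \<le> L * norm (x - y)"
      using lip L that by (intro exI[of _ L]) auto
  qed
  let ?Z = "sol (averaged f) 0 xhat"
  have Z: "solution_on (averaged f) 0 xhat {0..} ?Z"
    using stable by (intro solution_on_sol lip_av) (simp add: uniformly_asymptotically_stable_def)
  obtain R where R: "R > 0" "\<And>t. t \<ge> 0 \<Longrightarrow> norm (?Z t) \<le> R"
    using bounded_orbit unfolding bounded_pos by auto
  obtain M L where "averaging f (R + \<sigma>) M L" using av[of "R + \<sigma>"] R \<sigma> by auto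
  then interpret averaging f "R + \<sigma>" M L .
  obtain \<epsilon>0 where "\<epsilon>0 > 0" and close: "\<And>\<epsilon>. 0 < \<epsilon> \<and> \<epsilon> < \<epsilon>0 \<Longrightarrow>
      \<exists>X. solution_on (\<lambda>t x. f (t / \<epsilon>) t x) 0 xhat {0..} X \<and> (\<forall>t\<ge>0. norm (X t - ?Z t) \<le> \<sigma>)"
    using averaging_halfline[OF lip_av stable R(2) \<sigma>] by auto
  show "\<exists>\<epsilon>\<sigma>>0. \<forall>\<epsilon>. 0 < \<epsilon> \<and> \<epsilon> < \<epsilon>\<sigma> \<longrightarrow>
      (sol_ivl (\<lambda>t x. f (t / \<epsilon>) t x) 0 xhat = {0..} \<and>
       (\<forall>t\<ge>0. norm (sol (\<lambda>t x. f (t / \<epsilon>) t x) 0 xhat t - ?Z t) \<le> \<sigma>)) \<and>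
      (sol_ivl (\<lambda>\<tau> x. \<epsilon> *\<^sub>R f \<tau> (\<epsilon> * \<tau>) x) 0 xhat = {0..} \<and>
       (\<forall>\<tau>\<ge>0. norm (sol (\<lambda>\<tau> x. \<epsilon> *\<^sub>R f \<tau> (\<epsilon> * \<tau>) x) 0 xhat \<tau>
                   - sol (\<lambda>\<tau> z. \<epsilon> *\<^sub>R averaged f (\<epsilon> * \<tau>) z) 0 xhat \<tau>) \<le> \<sigma>))"
  proof (intro exI[of _ \<epsilon>0] conjI allI impI \<open>\<epsilon>0 > 0\<close>; (elim conjE)?)
    fix \<epsilon> :: real assume \<epsilon>: "0 < \<epsilon>" "\<epsilon> < \<epsilon>0"
    then obtain X where X: "solution_on (\<lambda>t x. f (t / \<epsilon>) t x) 0 xhat {0..} X"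
      and XZ: "\<And>t. t \<ge> 0 \<Longrightarrow> norm (X t - ?Z t) \<le> \<sigma>"
      using close by blast
    note slow = global_solution_eq_sol[OF lip_f[OF \<epsilon>(1)] X]
    note fast = global_solution_eq_sol[OF locally_lipschitz_from_rescale[OF lip_f[OF \<epsilon>(1)] \<epsilon>(1)]
        solution_on_rescale[OF X \<epsilon>(1)]]
    note mean = global_solution_eq_sol[OF locally_lipschitz_from_rescale[OF lip_av \<epsilon>(1)]
        solution_on_rescale[OF Z \<epsilon>(1)]]
    \<comment> \<open>The rescaled slow field has fast argument
      \<open>\<epsilon> * \<tau> / \<epsilon>\<close>; this identifies it with the field of the fast
      equation.\<close>
    have field: "(\<lambda>\<tau> x. \<epsilon> *\<^sub>R f (\<epsilon> * \<tau> / \<epsilon>) (\<epsilon> * \<tau>) x) = (\<lambda>\<tau> x. \<epsilon> *\<^sub>R f \<tau> (\<epsilon> * \<tau>) x)"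
      using \<epsilon> by simp
    show "sol_ivl (\<lambda>t x. f (t / \<epsilon>) t x) 0 xhat = {0..}"
      by (rule slow(1))
    show "sol_ivl (\<lambda>\<tau> x. \<epsilon> *\<^sub>R f \<tau> (\<epsilon> * \<tau>) x) 0 xhat = {0..}"
      using fast(1) unfolding field .
    show "norm (sol (\<lambda>t x. f (t / \<epsilon>) t x) 0 xhat t - ?Z t) \<le> \<sigma>" if "t \<ge> 0" for t
      using slow(2)[OF that] XZ[OF that] by simp
    show "norm (sol (\<lambda>\<tau> x. \<epsilon> *\<^sub>R f \<tau> (\<epsilon> * \<tau>) x) 0 xhat \<tau>
        - sol (\<lambda>\<tau> z. \<epsilon> *\<^sub>R averaged f (\<epsilon> * \<tau>) z) 0 xhat \<tau>) \<le> \<sigma>" if "\<tau> \<ge> 0" for \<tau>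
      using fast(2)[OF that] mean(2)[OF that] XZ[of "\<epsilon> * \<tau>"] that \<epsilon> unfolding field by simp
  qed
qed

end
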